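(* Let $P$ be a poset, $A\subseteq P$ and $\prec$ an approximating auxiliary relation on $P$. Then \[\operatorname{int}_\sigma(A)\subseteq\operatorname{int}_{\mu^\prec}(A)\subseteq A^{\downarrow\prec}\subseteq A\subseteq A^{\uparrow\prec}\subseteq\operatorname{cl}_{\mu^\prec}(A)\subseteq\operatorname{cl}_\sigma(A).\]
   Context: For a poset $(P,\le)$, $\mathord{\downarrow}X=\{x\mid\exists y\in X,\ x\le y\}$, $\mathord{\uparrow}X$ dually. A subset is directed if nonempty and every finite subset has an upper bound in it. An auxiliary relation on $P$ is a binary relation $\prec$ such that: $x\prec y$ implies $x\le y$; $u\le x\prec y\le z$ implies $u\prec z$; if $P$ has a least element $\bot$ then $\bot\prec x$ for all $x$. Write $s_\prec(x)=\{y\mid y\prec x\}$; $\prec$ is approximating if every $s_\prec(x)$ is directed with $\bigvee s_\prec(x)=x$. $A^{\downarrow\prec}=\{x\in A\mid s_\prec(x)\cap A\ne\emptyset\}$, $A^{\uparrow\prec}=\{x\in P\mid s_\prec(x)\subseteq\mathord{\downarrow}A\}$. $U$ is $\prec$-open if $U=\mathord{\uparrow}U$ and $U=U^{\downarrow\prec}$; these form a topology $\mu^\prec(P)$ with interior/closure $\operatorname{int}_{\mu^\prec}$, $\operatorname{cl}_{\mu^\prec}$. Scott open sets: upper sets $U$ such that whenever $D$ is directed with $\bigvee D$ existing and in $U$, $D\cap U\neq\emptyset$; $\operatorname{int}_\sigma,\operatorname{cl}_\sigma$ are Scott interior and closure. *)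

theory Defs
  imports "HOL-Library.Lub_Glb" "HOL-Analysis.Abstract_Topology"
begin

definition down_closure :: "'a::order set \<Rightarrow> 'a set" where
  "down_closure X = {x. \<exists>y\<in>X. x \<le> y}"

definition up_closure :: "'a::order set \<Rightarrow> 'a set" where
  "up_closure X = {x. \<exists>y\<in>X. y \<le> x}"

definition directed_set :: "'a::order set \<Rightarrow> bool" where
  "directed_set D \<longleftrightarrow>
     D \<noteq> {} \<and> (\<forall>F. finite F \<and> F \<subseteq> D \<longrightarrow> (\<exists>u\<in>D. \<forall>x\<in>F. x \<le> u))"

definition auxiliary_relation :: "('a::order \<Rightarrow> 'a \<Rightarrow> bool) \<Rightarrow> bool" where
  "auxiliary_relation prec \<longleftrightarrow>
     (\<forall>x y. prec x y \<longrightarrow> x \<le> y) \<and>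
     (\<forall>u x y z. u \<le> x \<and> prec x y \<and> y \<le> z \<longrightarrow> prec u z) \<and>
     (\<forall>b. (\<forall>x. b \<le> x) \<longrightarrow> (\<forall>x. prec b x))"

definition below_set :: "('a::order \<Rightarrow> 'a \<Rightarrow> bool) \<Rightarrow> 'a \<Rightarrow> 'a set" where
  "below_set prec x = {y. prec y x}"

text \<open>\<^term>\<open>isLub UNIV S x\<close> says that the supremum of \<^term>\<open>S\<close> in the whole poset
  exists and equals \<^term>\<open>x\<close>.\<close>

definition approximating :: "('a::order \<Rightarrow> 'a \<Rightarrow> bool) \<Rightarrow> bool" where
  "approximating prec \<longleftrightarrow>
     (\<forall>x. directed_set (below_set prec x) \<and> isLub UNIV (below_set prec x) x)"

definition lower_approx :: "('a::order \<Rightarrow> 'a \<Rightarrow> bool) \<Rightarrow> 'a set \<Rightarrow> 'a set" where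
  "lower_approx prec A = {x\<in>A. below_set prec x \<inter> A \<noteq> {}}"

definition upper_approx :: "('a::order \<Rightarrow> 'a \<Rightarrow> bool) \<Rightarrow> 'a set \<Rightarrow> 'a set" where
  "upper_approx prec A = {x. below_set prec x \<subseteq> down_closure A}"

definition prec_open :: "('a::order \<Rightarrow> 'a \<Rightarrow> bool) \<Rightarrow> 'a set \<Rightarrow> bool" where
  "prec_open prec U \<longleftrightarrow> U = up_closure U \<and> U = lower_approx prec U"

definition scott_open :: "'a::order set \<Rightarrow> bool" where
  "scott_open U \<longleftrightarrow>
     U = up_closure U \<and>
     (\<forall>D x. directed_set D \<and> isLub UNIV D x \<and> x \<in> U \<longrightarrow> D \<inter> U \<noteq> {})"

text \<open>The type of topologies is total: \<^term>\<open>topology P\<close> is only meaningful where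
  \<^term>\<open>istopology P\<close> holds. For \<^term>\<open>prec_open prec\<close> this needs the sets
  \<^term>\<open>below_set prec x\<close> to be directed; see the lemmas below.\<close>

definition mu_topology :: "('a::order \<Rightarrow> 'a \<Rightarrow> bool) \<Rightarrow> 'a topology" where
  "mu_topology prec = topology (prec_open prec)"

definition scott_topology :: "'a::order topology" where
  "scott_topology = topology scott_open"

lemma directed_set_upper2:
  assumes "directed_set D" "x \<in> D" "y \<in> D"
  obtains u where "u \<in> D" "x \<le> u" "y \<le> u"
proof -
  have "finite {x, y} \<and> {x, y} \<subseteq> D" using assms by simp
  then have "\<exists>u\<in>D. \<forall>w\<in>{x, y}. w \<le> u"
    using assms(1) unfolding directed_set_def by blast
  then show thesis using that by auto
qed

lemma up_closure_eq_iff: "U = up_closure U \<longleftrightarrow> (\<forall>x y. x \<in> U \<longrightarrow> x \<le> y \<longrightarrow> y \<in> U)"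
proof -
  have "U \<subseteq> up_closure U"
    unfolding up_closure_def by auto
  then have "U = up_closure U \<longleftrightarrow> up_closure U \<subseteq> U"
    by blast
  also have "\<dots> \<longleftrightarrow> (\<forall>x y. x \<in> U \<longrightarrow> x \<le> y \<longrightarrow> y \<in> U)"
    unfolding up_closure_def by blast
  finally show ?thesis .
qed

lemma lower_approx_eq_iff:
  "U = lower_approx prec U \<longleftrightarrow> (\<forall>x\<in>U. \<exists>y\<in>U. prec y x)"
proof -
  have "lower_approx prec U \<subseteq> U"
    unfolding lower_approx_def by blast
  then have "U = lower_approx prec U \<longleftrightarrow> U \<subseteq> lower_approx prec U"
    by blast
  also have "\<dots> \<longleftrightarrow> (\<forall>x\<in>U. \<exists>y\<in>U. prec y x)"
    unfolding lower_approx_def below_set_def by blast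
  finally show ?thesis .
qed

lemma prec_open_iff:
  "prec_open prec U \<longleftrightarrow>
     (\<forall>x y. x \<in> U \<longrightarrow> x \<le> y \<longrightarrow> y \<in> U) \<and> (\<forall>x\<in>U. \<exists>y\<in>U. prec y x)"
  unfolding prec_open_def by (simp only: up_closure_eq_iff[symmetric] lower_approx_eq_iff[symmetric])

lemma istopology_prec_open:
  assumes "approximating prec"
  shows "istopology (prec_open prec)"
  unfolding istopology_def
proof (intro conjI allI impI)
  fix S T assume S: "prec_open prec S" and T: "prec_open prec T"
  have up: "y \<in> S \<inter> T" if "x \<in> S \<inter> T" "x \<le> y" for x y
    using S T that unfolding prec_open_iff by blast
  have "\<exists>y\<in>S \<inter> T. prec y x" if x: "x \<in> S \<inter> T" for x
  proof -
    from S x obtain y where y: "y \<in> S" "prec y x"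
      unfolding prec_open_iff by blast
    from T x obtain z where z: "z \<in> T" "prec z x"
      unfolding prec_open_iff by blast
    have "directed_set (below_set prec x)"
      using assms by (simp add: approximating_def)
    moreover have "y \<in> below_set prec x" "z \<in> below_set prec x"
      using y z by (simp_all add: below_set_def)
    ultimately obtain w where w: "w \<in> below_set prec x" "y \<le> w" "z \<le> w"
      by (rule directed_set_upper2)
    have "w \<in> S" using S y(1) w(2) unfolding prec_open_iff by blast
    moreover have "w \<in> T" using T z(1) w(3) unfolding prec_open_iff by blast
    moreover have "prec w x" using w(1) by (simp add: below_set_def)
    ultimately show ?thesis by blast
  qed
  with up show "prec_open prec (S \<inter> T)"
    unfolding prec_open_iff by blast
next
  fix K assume K: "\<forall>S\<in>K. prec_open prec S"
  have "y \<in> \<Union>K" if "x \<in> \<Union>K" "x \<le> y" for x y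
    using K that unfolding prec_open_iff by blast
  moreover have "\<exists>y\<in>\<Union>K. prec y x" if "x \<in> \<Union>K" for x
    using K that unfolding prec_open_iff by blast
  ultimately show "prec_open prec (\<Union>K)"
    unfolding prec_open_iff by blast
qed

lemma istopology_scott_open: "istopology (scott_open :: 'a::order set \<Rightarrow> bool)"
  unfolding istopology_def
proof (intro conjI allI impI)
  fix S T :: "'a set" assume S: "scott_open S" and T: "scott_open T"
  have "D \<inter> (S \<inter> T) \<noteq> {}" if D: "directed_set D" "isLub UNIV D x" "x \<in> S \<inter> T" for D x
  proof -
    obtain y z where "y \<in> S" "y \<in> D" "z \<in> T" "z \<in> D"
      using S T D unfolding scott_open_def by blast
    then obtain w where "w \<in> D" "y \<le> w" "z \<le> w"
      using directed_set_upper2[OF D(1), of y z] by blast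
    with \<open>y \<in> S\<close> \<open>z \<in> T\<close> show ?thesis
      using S T unfolding scott_open_def up_closure_eq_iff by blast
  qed
  then show "scott_open (S \<inter> T)"
    using S T unfolding scott_open_def up_closure_eq_iff by blast
next
  fix K :: "'a set set" assume "\<forall>S\<in>K. scott_open S"
  then show "scott_open (\<Union>K)"
    unfolding scott_open_def up_closure_eq_iff by blast
qed

lemma openin_mu_topology:
  "approximating prec \<Longrightarrow> openin (mu_topology prec) U \<longleftrightarrow> prec_open prec U"
  unfolding mu_topology_def by (simp add: istopology_prec_open)

lemma openin_scott_topology: "openin scott_topology U \<longleftrightarrow> scott_open U"
  unfolding scott_topology_def by (simp add: istopology_scott_open)

lemma topspace_mu_topology:
  assumes "approximating prec"
  shows "topspace (mu_topology prec) = UNIV"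
proof -
  have "\<exists>y. prec y x" for x
    using assms unfolding approximating_def directed_set_def below_set_def by blast
  then have "prec_open prec UNIV"
    unfolding prec_open_def up_closure_eq_iff lower_approx_eq_iff by blast
  then show ?thesis
    using openin_subset openin_mu_topology[OF assms] by blast
qed

lemma topspace_scott_topology: "topspace scott_topology = UNIV"
proof -
  have "scott_open UNIV"
    unfolding scott_open_def up_closure_eq_iff directed_set_def by blast
  then show ?thesis
    using openin_subset openin_scott_topology by blast
qed

end

theory Submission
  imports Defs
begin

text \<open>Approximation makes each x the supremum of the directed set
  \<open>below_set prec x\<close>, so a Scott open set containing x must meet that set. Hence every
  Scott open set is \<open>prec\<close>-open, and since a finer topology has larger interiors and
  smaller closures, the two outermost inclusions follow. The inclusions between \<open>A\<close>,
  its approximations and the finer topology rest on one property: a \<open>prec\<close>-open set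
  contains, with each point, some element \<open>prec\<close>-below it.\<close>

lemma scott_open_imp_prec_open:
  assumes "approximating prec" "scott_open U"
  shows "prec_open prec U"
proof -
  have "\<exists>y\<in>U. prec y x" if "x \<in> U" for x
  proof -
    have "directed_set (below_set prec x)" "isLub UNIV (below_set prec x) x"
      using assms(1) unfolding approximating_def by blast+
    then have "below_set prec x \<inter> U \<noteq> {}"
      using assms(2) that unfolding scott_open_def by blast
    then show ?thesis
      unfolding below_set_def by blast
  qed
  moreover have "\<forall>x y. x \<in> U \<longrightarrow> x \<le> y \<longrightarrow> y \<in> U"
    using assms(2) unfolding scott_open_def up_closure_eq_iff by blast
  ultimately show ?thesis
    unfolding prec_open_iff by blast
qed

text \<open>A \<open>prec\<close>-open set inside \<open>A\<close> around x already supplies the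
  element of \<open>A\<close> that is \<open>prec\<close>-below x.\<close>

lemma interior_of_mu_subset_lower_approx:
  assumes "approximating prec"
  shows "mu_topology prec interior_of A \<subseteq> lower_approx prec A"
proof
  fix x assume "x \<in> mu_topology prec interior_of A"
  then obtain U where "prec_open prec U" "x \<in> U" "U \<subseteq> A"
    unfolding interior_of_def openin_mu_topology[OF assms] by blast
  then show "x \<in> lower_approx prec A"
    unfolding prec_open_iff lower_approx_def below_set_def by blast
qed

text \<open>Any \<open>prec\<close>-open neighbourhood of x reaches down to some y with
  \<open>prec y x\<close>. This y lies under a point of \<open>A\<close>, and since the
  neighbourhood is an upper set, it contains that point.\<close>

lemma upper_approx_subset_closure_of_mu:
  assumes "approximating prec"
  shows "upper_approx prec A \<subseteq> mu_topology prec closure_of A"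
proof
  fix x assume x: "x \<in> upper_approx prec A"
  have "\<exists>a\<in>A. a \<in> U" if U: "prec_open prec U" "x \<in> U" for U
  proof -
    obtain y where "y \<in> U" "prec y x"
      using U unfolding prec_open_iff by blast
    moreover from this obtain a where "a \<in> A" "y \<le> a"
      using x unfolding upper_approx_def below_set_def down_closure_def by blast
    ultimately show ?thesis
      using U(1) unfolding prec_open_iff by blast
  qed
  then show "x \<in> mu_topology prec closure_of A"
    unfolding closure_of_def openin_mu_topology[OF assms] topspace_mu_topology[OF assms]
    by blast
qed

theorem theorem3p24:
  fixes A :: "'a::order set" and prec :: "'a \<Rightarrow> 'a \<Rightarrow> bool"
  assumes "auxiliary_relation prec" and "approximating prec"
  shows "scott_topology interior_of A \<subseteq> mu_topology prec interior_of A
    \<and> mu_topology prec interior_of A \<subseteq> lower_approx prec A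
    \<and> lower_approx prec A \<subseteq> A
    \<and> A \<subseteq> upper_approx prec A
    \<and> upper_approx prec A \<subseteq> mu_topology prec closure_of A
    \<and> mu_topology prec closure_of A \<subseteq> scott_topology closure_of A"
proof (intro conjI)
  show "scott_topology interior_of A \<subseteq> mu_topology prec interior_of A"
    using scott_open_imp_prec_open[OF assms(2)]
    unfolding interior_of_def openin_mu_topology[OF assms(2)] openin_scott_topology by blast
  \<comment> \<open>Both topologies live on the whole type, so only neighbourhoods matter, and the
    Scott open ones are among those that a point of the finer closure must pass.\<close>
  show "mu_topology prec closure_of A \<subseteq> scott_topology closure_of A"
    using scott_open_imp_prec_open[OF assms(2)]
    unfolding closure_of_def openin_mu_topology[OF assms(2)] openin_scott_topology
      topspace_mu_topology[OF assms(2)] topspace_scott_topology by blast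
  show "mu_topology prec interior_of A \<subseteq> lower_approx prec A"
    by (rule interior_of_mu_subset_lower_approx[OF assms(2)])
  show "upper_approx prec A \<subseteq> mu_topology prec closure_of A"
    by (rule upper_approx_subset_closure_of_mu[OF assms(2)])
  show "lower_approx prec A \<subseteq> A"
    unfolding lower_approx_def by blast
  \<comment> \<open>As \<open>prec\<close> refines the order, each point of \<open>A\<close> itself
    bounds everything \<open>prec\<close>-below it.\<close>
  show "A \<subseteq> upper_approx prec A"
    using assms(1)
    unfolding upper_approx_def below_set_def down_closure_def auxiliary_relation_def by blast
qed

end
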